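(* Let $(I,A)$ be a strategic game form and let $n>0$ be a real number. The set $$M_n:=\{(u,x): u\in\mathbf{R}^{A\times I},\ x\in X,\ x \text{ is an } O_n\text{-equilibrium of the game } (I,A,u)\}\subset\mathbf{R}^{A\times I}\times\mathbf{R}^{\cup_{i\in I}A_i}$$ is a (smooth) manifold of dimension $|A|\cdot|I|$.
   Context: A strategic game form is a pair $(I,A)$ where $I$ is a finite set of players and $A=\times_{i\in I}A_i$ is a Cartesian product of finite (nonempty, pairwise disjoint) action sets. A payoff function is $u=(u_i)_{i\in I}$ with $u_i:A\to\mathbf{R}$; the set of payoff functions is $\mathbf{R}^{A\times I}$, and $(I,A,u)$ is a game. The set of (mixed) strategy profiles is $X=\times_{i\in I}\Delta(A_i)\subset\mathbf{R}^{\cup_{i\in I}A_i}$, and each $u_i$ is extended multilinearly to $X$; $u_i(a_i,x_{-i})$ is the payoff when player $i$ plays $a_i$ and the others play according to $x$. For $n>0$, a strategy profile $x\in X$ is an $O_n$-equilibrium of the game $(I,A,u)$ if for every player $i\in I$ and every action $a_i\in A_i$, $$x_i(a_i)=\frac{\exp(n\,u_i(a_i,x_{-i}))}{\sum_{a_i'\in A_i}\exp(n\,u_i(a_i',x_{-i}))}.$$ *)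

theory Defs
  imports "HOL-Analysis.Analysis"
begin

section \<open>Smooth submanifolds of Euclidean spaces\<close>

(* f is C^k on the open set S: for k + 1, f is differentiable on S and every directional
   derivative x |-> Df(x) v is C^k on S. Only used for open S. *)
primrec Ck_on :: "nat \<Rightarrow> ('a::euclidean_space \<Rightarrow> 'b::euclidean_space) \<Rightarrow> 'a set \<Rightarrow> bool" where
  "Ck_on 0 f S \<longleftrightarrow> continuous_on S f"
| "Ck_on (Suc k) f S \<longleftrightarrow>
     (\<forall>x\<in>S. f differentiable (at x)) \<and>
     (\<forall>v. Ck_on k (\<lambda>x. frechet_derivative f (at x) v) S)"

definition smooth_on :: "('a::euclidean_space \<Rightarrow> 'b::euclidean_space) \<Rightarrow> 'a set \<Rightarrow> bool" where
  "smooth_on f S \<longleftrightarrow> (\<forall>k. Ck_on k f S)"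

definition diffeomorphism_between ::
    "'a::euclidean_space set \<Rightarrow> 'b::euclidean_space set \<Rightarrow> ('a \<Rightarrow> 'b) \<Rightarrow> ('b \<Rightarrow> 'a) \<Rightarrow> bool" where
  "diffeomorphism_between U V \<phi> \<psi> \<longleftrightarrow>
     open U \<and> open V \<and> homeomorphism U V \<phi> \<psi> \<and> smooth_on \<phi> U \<and> smooth_on \<psi> V"

(* Local slice charts. The model R^k is an arbitrary k-dimensional linear subspace L of the
   ambient space, because k need not be the dimension of a type. *)
definition smooth_submanifold :: "nat \<Rightarrow> 'a::euclidean_space set \<Rightarrow> bool" where
  "smooth_submanifold k M \<longleftrightarrow>
     (\<forall>p\<in>M. \<exists>(U::'a set) (V::'a set) \<phi> \<psi> L.
        p \<in> U \<and> diffeomorphism_between U V \<phi> \<psi> \<and>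
        subspace L \<and> dim L = k \<and> \<phi> ` (U \<inter> M) = V \<inter> L)"


section \<open>Games\<close>

(* The players are the elements of I and the actions of player i are the elements of A i; I and
   the A i may be proper subsets of their (finite) types. *)
definition strategic_game_form :: "'i::finite set \<Rightarrow> ('i \<Rightarrow> 'a::finite set) \<Rightarrow> bool" where
  "strategic_game_form I A \<longleftrightarrow> (\<forall>i\<in>I. A i \<noteq> {}) \<and> disjoint_family_on A I"

abbreviation action_profiles :: "'i set \<Rightarrow> ('i \<Rightarrow> 'a set) \<Rightarrow> ('i \<Rightarrow> 'a) set" where
  "action_profiles I A \<equiv> PiE I A"

(* The number u_i(a) is the coordinate u $ (a, i). The space of real vectors indexed by
   A x I is the coordinate subspace on which all other coordinates vanish; likewise below for
   vectors indexed by the union of the A i. Being a k-dimensional submanifold does not depend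
   on whether the coordinate subspace or the full space is taken as ambient space. *)
definition payoff_functions ::
    "'i::finite set \<Rightarrow> ('i \<Rightarrow> 'a::finite set) \<Rightarrow> (real ^ (('i \<Rightarrow> 'a) \<times> 'i)) set" where
  "payoff_functions I A = {u. \<forall>p. p \<notin> action_profiles I A \<times> I \<longrightarrow> u $ p = 0}"

(* Since the action sets are disjoint, x_i(c) is just the coordinate x $ c, for c in A i. *)
definition strategy_profiles :: "'i::finite set \<Rightarrow> ('i \<Rightarrow> 'a::finite set) \<Rightarrow> (real ^ 'a) set" where
  "strategy_profiles I A =
     {x. (\<forall>c. c \<notin> (\<Union>i\<in>I. A i) \<longrightarrow> x $ c = 0) \<and>
         (\<forall>i\<in>I. (\<forall>c\<in>A i. 0 \<le> x $ c) \<and> (\<Sum>c\<in>A i. x $ c) = 1)}"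

(* Multilinear extension of u_i to mixed strategies. *)
definition expected_payoff ::
    "'i::finite set \<Rightarrow> ('i \<Rightarrow> 'a::finite set) \<Rightarrow> real ^ (('i \<Rightarrow> 'a) \<times> 'i) \<Rightarrow> 'i \<Rightarrow> real ^ 'a \<Rightarrow> real" where
  "expected_payoff I A u i x =
     (\<Sum>a\<in>action_profiles I A. (\<Prod>j\<in>I. x $ a j) * u $ (a, i))"

(* The strategy profile in which i plays the action b for sure and the others play as in x. *)
definition deviation ::
    "('i::finite \<Rightarrow> 'a::finite set) \<Rightarrow> real ^ 'a \<Rightarrow> 'i \<Rightarrow> 'a \<Rightarrow> real ^ 'a" where
  "deviation A x i b = (\<chi> c. if c \<in> A i then (if c = b then 1 else 0) else x $ c)"

abbreviation deviation_payoff ::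
    "'i::finite set \<Rightarrow> ('i \<Rightarrow> 'a::finite set) \<Rightarrow> real ^ (('i \<Rightarrow> 'a) \<times> 'i) \<Rightarrow> 'i \<Rightarrow> 'a \<Rightarrow> real ^ 'a \<Rightarrow> real" where
  "deviation_payoff I A u i b x \<equiv> expected_payoff I A u i (deviation A x i b)"

definition O_equilibrium ::
    "real \<Rightarrow> 'i::finite set \<Rightarrow> ('i \<Rightarrow> 'a::finite set) \<Rightarrow> real ^ (('i \<Rightarrow> 'a) \<times> 'i) \<Rightarrow> real ^ 'a \<Rightarrow> bool" where
  "O_equilibrium n I A u x \<longleftrightarrow>
     x \<in> strategy_profiles I A \<and>
     (\<forall>i\<in>I. \<forall>b\<in>A i.
        x $ b = exp (n * deviation_payoff I A u i b x) /
                (\<Sum>c\<in>A i. exp (n * deviation_payoff I A u i c x)))"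

end

theory Submission
  imports Defs
begin

text \<open>
  Fix a reference action profile \<open>r\<close> and split \<open>u\<^sub>i(a) = v\<^sub>i(a) + u\<^sub>i(a\<^sub>i, r\<^sub>-\<^sub>i)\<close>, where \<open>v\<close> is the
  residual game. Adding to \<open>u\<^sub>i(a)\<close> a function of \<open>a\<^sub>i\<close> does not change \<open>v\<close>. Hence, as in the
  Kohlberg--Mertens structure theorem, \<open>w\<^sub>i(a) = u\<^sub>i(a) + v\<^sub>i(a\<^sub>i, x\<^sub>-\<^sub>i)\<close> can be solved for \<open>u\<close> given \<open>x\<close>,
  and \<open>w\<^sub>i(b, r\<^sub>-\<^sub>i) = u\<^sub>i(b, x\<^sub>-\<^sub>i)\<close> for strategy profiles \<open>x\<close>. So \<open>x\<close> is an \<open>O\<^sub>n\<close>-equilibrium of \<open>u\<close>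
  iff it is the logit response to the numbers \<open>w\<^sub>i(b, r\<^sub>-\<^sub>i)\<close>, and
  \<open>(u, x) \<mapsto> (w, x - logit(w))\<close> is a diffeomorphism of the whole ambient space which
  maps the equilibrium graph onto the coordinate subspace of all \<open>(w, 0)\<close>.
\<close>

section \<open>Calculus of smooth functions\<close>

text \<open>On an open set the derivative at a point depends only on nearby values, so
  \<open>f\<close> and \<open>g\<close> have the same derivatives there and induction on
  \<open>k\<close> applies to these.\<close>

lemma Ck_on_cong:
  assumes "open S" "\<And>x. x \<in> S \<Longrightarrow> f x = g x"
  shows "Ck_on k f S \<longleftrightarrow> Ck_on k g S"
proof -
  have "Ck_on k g S" if "open S" "\<And>x. x \<in> S \<Longrightarrow> f x = g x" "Ck_on k f S" for f g :: "'a \<Rightarrow> 'b"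
    using that
  proof (induction k arbitrary: f g)
    case 0
    then show ?case by (simp cong: continuous_on_cong)
  next
    case (Suc k)
    have der: "(g has_derivative frechet_derivative f (at x)) (at x)" if "x \<in> S" for x
    proof (rule has_derivative_transform_within_open[OF _ Suc.prems(1) that])
      show "(f has_derivative frechet_derivative f (at x)) (at x)"
        using Suc.prems(3) that by (auto simp: frechet_derivative_works)
    qed (use Suc.prems(2) in auto)
    have eq: "frechet_derivative f (at x) = frechet_derivative g (at x)" if "x \<in> S" for x
      by (rule frechet_derivative_at[OF der[OF that]])
    have "Ck_on k (\<lambda>x. frechet_derivative g (at x) v) S" for v
    proof (rule Suc.IH[OF Suc.prems(1)])
      show "Ck_on k (\<lambda>x. frechet_derivative f (at x) v) S" using Suc.prems(3) by simp
    qed (simp add: eq)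
    with der show ?case by (auto simp: differentiable_def)
  qed
  from this[of f g] this[of g f] show ?thesis using assms by metis
qed

text \<open>Uniqueness of the derivative lets an explicit formula \<open>D\<close> replace
  \<open>frechet_derivative\<close>. The closure rules below then reduce to a differentiation rule
  plus the induction hypothesis.\<close>

lemma Ck_on_SucI:
  assumes "open S" "\<And>x. x \<in> S \<Longrightarrow> (f has_derivative D x) (at x)"
    and "\<And>v. Ck_on k (\<lambda>x. D x v) S"
  shows "Ck_on (Suc k) f S"
proof -
  have "frechet_derivative f (at x) = D x" if "x \<in> S" for x
    using assms(2)[OF that] frechet_derivative_at by metis
  then have "Ck_on k (\<lambda>x. frechet_derivative f (at x) v) S" for v
    using assms(3)[of v] by (subst Ck_on_cong[OF assms(1), where g = "\<lambda>x. D x v"]) auto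
  then show ?thesis using assms(2) by (auto simp: differentiable_def)
qed

lemma Ck_on_SucD_derivative:
  assumes "Ck_on (Suc k) f S" "x \<in> S"
  shows "(f has_derivative frechet_derivative f (at x)) (at x)"
  using assms by (auto simp: frechet_derivative_works)

lemma Ck_on_Suc_imp_Ck_on: "Ck_on (Suc k) f S \<Longrightarrow> Ck_on k f S"
proof (induction k arbitrary: f)
  case 0
  then show ?case
    by (auto intro!: continuous_at_imp_continuous_on differentiable_imp_continuous_within)
next
  case (Suc k)
  have "Ck_on k (\<lambda>x. frechet_derivative f (at x) v) S" for v
    using Suc.prems by (intro Suc.IH) simp
  with Suc.prems show ?case by simp
qed

section \<open>Closure properties of C^k functions\<close>

lemma Ck_on_const: "open S \<Longrightarrow> Ck_on k (\<lambda>x. c) S"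
proof (induction k arbitrary: c)
  case (Suc k)
  then show ?case by (intro Ck_on_SucI[where D = "\<lambda>_ _. 0"]) (auto intro!: derivative_eq_intros)
qed auto

lemma Ck_on_bounded_linear_compose:
  assumes h: "bounded_linear h" and S: "open S"
  shows "Ck_on k f S \<Longrightarrow> Ck_on k (\<lambda>x. h (f x)) S"
proof (induction k arbitrary: f)
  case 0
  then show ?case by (auto intro: bounded_linear.continuous_on[OF h])
next
  case (Suc k)
  show ?case
    by (rule Ck_on_SucI[OF S bounded_linear.has_derivative[OF h Ck_on_SucD_derivative[OF Suc.prems]]])
      (use Suc in auto)
qed

lemma Ck_on_ident: "open S \<Longrightarrow> Ck_on k (\<lambda>x. x) S"
proof (cases k)
  case (Suc m)
  then show "open S \<Longrightarrow> ?thesis" by (auto intro!: Ck_on_SucI[where D = "\<lambda>_ v. v"] Ck_on_const simp del: Ck_on.simps(2))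
qed auto

lemma Ck_on_bounded_linear: "bounded_linear h \<Longrightarrow> open S \<Longrightarrow> Ck_on k h S"
  using Ck_on_bounded_linear_compose[OF _ _ Ck_on_ident] by blast

lemma Ck_on_add:
  assumes S: "open S"
  shows "Ck_on k f S \<Longrightarrow> Ck_on k g S \<Longrightarrow> Ck_on k (\<lambda>x. f x + g x) S"
proof (induction k arbitrary: f g)
  case 0
  then show ?case by (auto intro: continuous_intros)
next
  case (Suc k)
  show ?case
    by (rule Ck_on_SucI[OF S has_derivative_add[OF Ck_on_SucD_derivative[OF Suc.prems(1)]
            Ck_on_SucD_derivative[OF Suc.prems(2)]]])
      (use Suc in auto)
qed

lemma Ck_on_minus: "open S \<Longrightarrow> Ck_on k f S \<Longrightarrow> Ck_on k (\<lambda>x. - f x) S"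
  by (rule Ck_on_bounded_linear_compose[OF bounded_linear_minus[OF bounded_linear_ident]])

lemma Ck_on_diff:
  "open S \<Longrightarrow> Ck_on k f S \<Longrightarrow> Ck_on k g S \<Longrightarrow> Ck_on k (\<lambda>x. f x - g x) S"
  using Ck_on_add[OF _ _ Ck_on_minus, of S k f g] by simp

lemma Ck_on_sum:
  assumes "open S" "\<And>i. i \<in> J \<Longrightarrow> Ck_on k (f i) S"
  shows "Ck_on k (\<lambda>x. \<Sum>i\<in>J. f i x) S"
  using assms(2) by (induction J rule: infinite_finite_induct) (auto intro: Ck_on_const Ck_on_add assms(1))

text \<open>The product rule gives two products, each of a derivative and an undifferentiated
  factor. The latter is lowered from \<open>Suc k\<close> to \<open>k\<close> by
  \<open>Ck_on_Suc_imp_Ck_on\<close>, so the induction hypothesis covers both.\<close>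

lemma Ck_on_mult:
  fixes f g :: "'a::euclidean_space \<Rightarrow> real"
  assumes S: "open S"
  shows "Ck_on k f S \<Longrightarrow> Ck_on k g S \<Longrightarrow> Ck_on k (\<lambda>x. f x * g x) S"
proof (induction k arbitrary: f g)
  case 0
  then show ?case by (auto intro: continuous_intros)
next
  case (Suc k)
  show ?case
    by (rule Ck_on_SucI[OF S has_derivative_mult[OF Ck_on_SucD_derivative[OF Suc.prems(1)]
            Ck_on_SucD_derivative[OF Suc.prems(2)]]])
      (use Suc Suc.prems[THEN Ck_on_Suc_imp_Ck_on] in \<open>auto intro!: Ck_on_add S\<close>)
qed

lemma Ck_on_prod:
  fixes f :: "'i \<Rightarrow> 'a::euclidean_space \<Rightarrow> real"
  assumes "open S" "\<And>i. i \<in> J \<Longrightarrow> Ck_on k (f i) S"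
  shows "Ck_on k (\<lambda>x. \<Prod>i\<in>J. f i x) S"
  using assms(2) by (induction J rule: infinite_finite_induct) (auto intro: Ck_on_const Ck_on_mult assms(1))

text \<open>The derivative again contains \<open>exp (f x)\<close>, which is already C^k by the
  induction hypothesis; the same bootstrapping handles \<open>inverse\<close> below.\<close>

lemma Ck_on_exp:
  fixes f :: "'a::euclidean_space \<Rightarrow> real"
  assumes S: "open S"
  shows "Ck_on k f S \<Longrightarrow> Ck_on k (\<lambda>x. exp (f x)) S"
proof (induction k arbitrary: f)
  case 0
  then show ?case by (auto intro: continuous_intros)
next
  case (Suc k)
  have "Ck_on k (\<lambda>x. exp (f x)) S" using Suc Ck_on_Suc_imp_Ck_on by blast
  with Suc.prems have "Ck_on k (\<lambda>x. frechet_derivative f (at x) v * exp (f x)) S" for v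
    by (intro Ck_on_mult[OF S]) auto
  then show ?case
    by (intro Ck_on_SucI[OF S has_derivative_exp[OF Ck_on_SucD_derivative[OF Suc.prems]]])
qed

lemma Ck_on_inverse:
  fixes f :: "'a::euclidean_space \<Rightarrow> real"
  assumes S: "open S" and nz: "\<And>x. x \<in> S \<Longrightarrow> f x \<noteq> 0"
  shows "Ck_on k f S \<Longrightarrow> Ck_on k (\<lambda>x. inverse (f x)) S"
proof (induction k)
  case 0
  then show ?case using nz by (auto intro: continuous_intros)
next
  case (Suc k)
  have "Ck_on k (\<lambda>x. inverse (f x)) S" using Suc Ck_on_Suc_imp_Ck_on by blast
  with Suc.prems
  have "Ck_on k (\<lambda>x. - (inverse (f x) * frechet_derivative f (at x) v * inverse (f x))) S" for v
    by (intro Ck_on_mult[OF S] Ck_on_minus[OF S]) auto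
  then show ?case
    using nz
    by (intro Ck_on_SucI[OF S Deriv.has_derivative_inverse[OF _ Ck_on_SucD_derivative[OF Suc.prems]]])
qed

text \<open>Expansion in the standard basis writes \<open>f\<close> as a finite sum of scalar C^k
  functions times fixed vectors.\<close>

lemma Ck_on_vec:
  fixes f :: "'a::euclidean_space \<Rightarrow> real ^ 'n"
  assumes S: "open S" and "\<And>i. Ck_on k (\<lambda>x. f x $ i) S"
  shows "Ck_on k f S"
proof -
  have "f x = (\<Sum>i\<in>UNIV. f x $ i *\<^sub>R axis i 1)" for x
    using basis_expansion[of "f x"] by (simp add: scalar_mult_eq_scaleR)
  then have eq: "f = (\<lambda>x. \<Sum>i\<in>UNIV. f x $ i *\<^sub>R axis i 1)" by auto
  show ?thesis
    by (subst eq)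
      (intro Ck_on_sum S assms(2) Ck_on_bounded_linear_compose[OF bounded_linear_scaleR_left])
qed

lemma Ck_on_Pair:
  assumes S: "open S" and "Ck_on k f S" "Ck_on k g S"
  shows "Ck_on k (\<lambda>x. (f x, g x)) S"
proof -
  have "Ck_on k (\<lambda>x. (f x, 0) + (0, g x)) S"
    by (intro Ck_on_add S Ck_on_bounded_linear_compose[of "\<lambda>a. (a, 0)"]
        Ck_on_bounded_linear_compose[of "\<lambda>b. (0, b)"] assms bounded_linear_Pair
        bounded_linear_ident bounded_linear_zero)
  then show ?thesis by simp
qed


section \<open>Residual games and the logit response\<close>

text \<open>For \<open>p = (a, i)\<close> the entry is \<open>g i (a i)\<close>: a payoff that the
  opponents cannot influence. The default 0 keeps the game inside
  \<open>payoff_functions I A\<close>.\<close>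

definition own_action_game ::
    "'i::finite set \<Rightarrow> ('i \<Rightarrow> 'a::finite set) \<Rightarrow> ('i \<Rightarrow> 'a \<Rightarrow> real) \<Rightarrow> real ^ (('i \<Rightarrow> 'a) \<times> 'i)" where
  "own_action_game I A g =
     (\<chi> p. if p \<in> action_profiles I A \<times> I then g (snd p) (fst p (snd p)) else 0)"

definition reference_payoff ::
    "('i::finite \<Rightarrow> 'a::finite) \<Rightarrow> real ^ (('i \<Rightarrow> 'a) \<times> 'i) \<Rightarrow> 'i \<Rightarrow> 'a \<Rightarrow> real" where
  "reference_payoff r u i b = u $ (r(i := b), i)"

definition residual_game ::
    "'i::finite set \<Rightarrow> ('i \<Rightarrow> 'a::finite set) \<Rightarrow> ('i \<Rightarrow> 'a) \<Rightarrow> real ^ (('i \<Rightarrow> 'a) \<times> 'i) \<Rightarrow>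
     real ^ (('i \<Rightarrow> 'a) \<times> 'i)" where
  "residual_game I A r u = u - own_action_game I A (reference_payoff r u)"

text \<open>This is the correction \<open>w - u\<close> in the chart. It sees \<open>u\<close> only
  through its residual, which is what makes the chart explicitly invertible.\<close>

definition deviation_game ::
    "'i::finite set \<Rightarrow> ('i \<Rightarrow> 'a::finite set) \<Rightarrow> ('i \<Rightarrow> 'a) \<Rightarrow> real ^ (('i \<Rightarrow> 'a) \<times> 'i) \<Rightarrow> real ^ 'a \<Rightarrow>
     real ^ (('i \<Rightarrow> 'a) \<times> 'i)" where
  "deviation_game I A r u x =
     own_action_game I A (\<lambda>i b. deviation_payoff I A (residual_game I A r u) i b x)"

text \<open>Summing over players avoids choosing the owner of \<open>c\<close>: for disjoint action
  sets at most one summand is nonzero, and an action owned by nobody gets 0.\<close>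

definition logit_response ::
    "real \<Rightarrow> 'i::finite set \<Rightarrow> ('i \<Rightarrow> 'a::finite set) \<Rightarrow> ('i \<Rightarrow> 'a \<Rightarrow> real) \<Rightarrow> real ^ 'a" where
  "logit_response n I A g =
     (\<chi> c. \<Sum>i\<in>I. if c \<in> A i then exp (n * g i c) / (\<Sum>b\<in>A i. exp (n * g i b)) else 0)"

lemma fun_upd_in_PiE:
  assumes "r \<in> Pi\<^sub>E I A" "i \<in> I" "b \<in> A i"
  shows "r(i := b) \<in> Pi\<^sub>E I A"
  using assms by (auto simp: PiE_iff extensional_def)

lemma own_action_game_in_payoff_functions: "own_action_game I A g \<in> payoff_functions I A"
  by (auto simp: own_action_game_def payoff_functions_def)

lemma payoff_functions_add_iff:
  "v \<in> payoff_functions I A \<Longrightarrow> u + v \<in> payoff_functions I A \<longleftrightarrow> u \<in> payoff_functions I A"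
  by (simp add: payoff_functions_def)

lemma reference_payoff_add_own_action_game:
  assumes "r \<in> action_profiles I A" "i \<in> I" "b \<in> A i"
  shows "reference_payoff r (u + own_action_game I A g) i b = reference_payoff r u i b + g i b"
  using fun_upd_in_PiE[OF assms] assms
  by (simp add: reference_payoff_def own_action_game_def)

text \<open>The reference payoffs shift by exactly \<open>g\<close>, so the subtracted own-action
  part absorbs the added game.\<close>

lemma residual_game_add_own_action_game:
  assumes "r \<in> action_profiles I A"
  shows "residual_game I A r (u + own_action_game I A g) = residual_game I A r u"
proof -
  have "own_action_game I A (reference_payoff r (u + own_action_game I A g)) =
        own_action_game I A (reference_payoff r u) + own_action_game I A g"
  proof (rule vec_eq_iff[THEN iffD2, rule_format])
    fix p :: "('a \<Rightarrow> 'b) \<times> 'a"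
    show "own_action_game I A (reference_payoff r (u + own_action_game I A g)) $ p =
          (own_action_game I A (reference_payoff r u) + own_action_game I A g) $ p"
    proof (cases "p \<in> action_profiles I A \<times> I")
      case True
      then have "snd p \<in> I" "fst p (snd p) \<in> A (snd p)" by (auto simp: PiE_mem)
      from reference_payoff_add_own_action_game[OF assms this] True show ?thesis
        \<comment> \<open>Unfolding first only the games built from reference payoffs leaves
          \<open>own_action_game I A g\<close> folded, so that the shift identity can still
          rewrite.\<close>
        by (simp add: own_action_game_def[of I A "reference_payoff r _"])
          (simp add: own_action_game_def)
    qed (simp add: own_action_game_def)
  qed
  then show ?thesis by (simp add: residual_game_def)
qed

lemma deviation_game_add_own_action_game:
  assumes "r \<in> action_profiles I A"
  shows "deviation_game I A r (u + own_action_game I A g) x = deviation_game I A r u x"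
  using assms by (simp add: deviation_game_def residual_game_add_own_action_game)

section \<open>Payoffs from unilateral deviations\<close>

lemma deviation_in_strategy_profiles:
  assumes "disjoint_family_on A I" "x \<in> strategy_profiles I A" "i \<in> I" "b \<in> A i"
  shows "deviation A x i b \<in> strategy_profiles I A"
proof -
  have "c \<notin> A i" if "j \<in> I" "j \<noteq> i" "c \<in> A j" for j c
    using assms(1,3) that by (auto simp: disjoint_family_on_def)
  then have eq: "(\<Sum>c\<in>A j. deviation A x i b $ c) = (\<Sum>c\<in>A j. x $ c)" if "j \<in> I" "j \<noteq> i" for j
    using that by (intro sum.cong) (auto simp: deviation_def)
  moreover have "(\<Sum>c\<in>A i. deviation A x i b $ c) = 1"
    using assms(4) by (simp add: deviation_def)
  ultimately have "(\<Sum>c\<in>A j. deviation A x i b $ c) = 1" if "j \<in> I" for j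
    using assms(2) that by (cases "j = i") (auto simp: strategy_profiles_def)
  then show ?thesis using assms by (auto simp: strategy_profiles_def deviation_def)
qed

lemma expected_payoff_add:
  "expected_payoff I A (u + v) i x = expected_payoff I A u i x + expected_payoff I A v i x"
  by (simp add: expected_payoff_def algebra_simps sum.distrib)

text \<open>The sum over profiles of products factors into the product over players of their total
  masses, each equal to 1.\<close>

lemma sum_profile_probabilities:
  assumes "x \<in> strategy_profiles I A"
  shows "(\<Sum>a\<in>action_profiles I A. \<Prod>j\<in>I. x $ a j) = 1"
  using assms by (subst prod_sum_PiE[symmetric]) (auto simp: strategy_profiles_def)

text \<open>After the deviation, profiles with \<open>a i \<noteq> b\<close> have probability 0, all
  others pay \<open>g i b\<close>, and the total probability is 1.\<close>

lemma deviation_payoff_own_action_game: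
  assumes "disjoint_family_on A I" "x \<in> strategy_profiles I A" "i \<in> I" "b \<in> A i"
  shows "deviation_payoff I A (own_action_game I A g) i b x = g i b"
proof -
  let ?y = "deviation A x i b"
  have "(\<Prod>j\<in>I. ?y $ a j) * own_action_game I A g $ (a, i) = (\<Prod>j\<in>I. ?y $ a j) * g i b"
    if "a \<in> action_profiles I A" for a
  proof (cases "a i = b")
    case True
    then show ?thesis using that assms(3) by (simp add: own_action_game_def)
  next
    case False
    then have "?y $ a i = 0" using that assms(3) by (auto simp: deviation_def PiE_mem)
    then have "(\<Prod>j\<in>I. ?y $ a j) = 0" using assms(3) by (auto simp: prod_zero_iff)
    then show ?thesis by simp
  qed
  then have "deviation_payoff I A (own_action_game I A g) i b x =
             (\<Sum>a\<in>action_profiles I A. \<Prod>j\<in>I. ?y $ a j) * g i b"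
    unfolding expected_payoff_def sum_distrib_right by (intro sum.cong refl)
  then show ?thesis
    using sum_profile_probabilities[OF deviation_in_strategy_profiles[OF assms]] by simp
qed

text \<open>Split \<open>u\<close> into its own-action part and its residual. Under the deviation
  the first pays exactly the reference payoff, and the second pays exactly what the deviation game
  adds at the reference coordinate.\<close>

lemma reference_payoff_add_deviation_game:
  assumes "disjoint_family_on A I" "x \<in> strategy_profiles I A" "r \<in> action_profiles I A"
    and "i \<in> I" "b \<in> A i"
  shows "reference_payoff r (u + deviation_game I A r u x) i b = deviation_payoff I A u i b x"
proof -
  have "u = own_action_game I A (reference_payoff r u) + residual_game I A r u"
    by (simp add: residual_game_def)
  then have "deviation_payoff I A u i b x =
      deviation_payoff I A (own_action_game I A (reference_payoff r u)) i b x +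
      deviation_payoff I A (residual_game I A r u) i b x"
    by (metis expected_payoff_add)
  then show ?thesis
    using assms
    by (simp add: deviation_game_def reference_payoff_add_own_action_game
        deviation_payoff_own_action_game)
qed

section \<open>Logit responses and equilibria\<close>

lemma logit_response_nth:
  assumes "disjoint_family_on A I" "i \<in> I" "c \<in> A i"
  shows "logit_response n I A g $ c = exp (n * g i c) / (\<Sum>b\<in>A i. exp (n * g i b))"
proof -
  have "c \<in> A j \<longleftrightarrow> j = i" if "j \<in> I" for j
    using assms that by (auto simp: disjoint_family_on_def)
  then have "logit_response n I A g $ c =
      (\<Sum>j\<in>I. if j = i then exp (n * g j c) / (\<Sum>b\<in>A j. exp (n * g j b)) else 0)"
    unfolding logit_response_def by (auto intro!: sum.cong)
  also have "\<dots> = exp (n * g i c) / (\<Sum>b\<in>A i. exp (n * g i b))"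
    using assms(2) by simp
  finally show ?thesis .
qed

lemma logit_response_in_strategy_profiles:
  assumes "strategic_game_form I A"
  shows "logit_response n I A g \<in> strategy_profiles I A"
proof -
  have disj: "disjoint_family_on A I" using assms by (simp add: strategic_game_form_def)
  have pos: "(\<Sum>b\<in>A i. exp (n * g i b)) > 0" if "i \<in> I" for i
    using assms that by (intro sum_pos) (auto simp: strategic_game_form_def)
  have "(\<Sum>c\<in>A i. logit_response n I A g $ c) = 1" if "i \<in> I" for i
    using pos[OF that] by (simp add: logit_response_nth[OF disj that] flip: sum_divide_distrib)
  moreover have "logit_response n I A g $ c = 0" if "c \<notin> (\<Union>i\<in>I. A i)" for c
    using that by (auto simp: logit_response_def intro!: sum.neutral)
  moreover have "0 \<le> logit_response n I A g $ c" if "i \<in> I" "c \<in> A i" for i c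
    using pos[OF that(1)] by (simp add: logit_response_nth[OF disj that])
  ultimately show ?thesis by (auto simp: strategy_profiles_def)
qed

lemma strategy_profiles_eqI:
  assumes "x \<in> strategy_profiles I A" "y \<in> strategy_profiles I A"
    and "\<And>i c. i \<in> I \<Longrightarrow> c \<in> A i \<Longrightarrow> x $ c = y $ c"
  shows "x = y"
proof -
  have "x $ c = y $ c" for c
    using assms by (cases "c \<in> (\<Union>i\<in>I. A i)") (auto simp: strategy_profiles_def)
  then show ?thesis by (simp add: vec_eq_iff)
qed

text \<open>One equation encodes both the equilibrium condition and the constraints defining
  strategy profiles, because every logit response is itself a strategy profile.\<close>

lemma O_equilibrium_iff_logit_response:
  assumes form: "strategic_game_form I A" and r: "r \<in> action_profiles I A"
  shows "x \<in> strategy_profiles I A \<and> O_equilibrium n I A u x \<longleftrightarrow>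
         x = logit_response n I A (reference_payoff r (u + deviation_game I A r u x))"
    (is "?L \<longleftrightarrow> x = ?R")
proof -
  have disj: "disjoint_family_on A I" using form by (simp add: strategic_game_form_def)
  have R: "?R \<in> strategy_profiles I A" by (rule logit_response_in_strategy_profiles[OF form])
  have *: "?R $ b = exp (n * deviation_payoff I A u i b x) /
                    (\<Sum>c\<in>A i. exp (n * deviation_payoff I A u i c x))"
    if "x \<in> strategy_profiles I A" "i \<in> I" "b \<in> A i" for i b
    using that
    by (simp add: logit_response_nth[OF disj] reference_payoff_add_deviation_game[OF disj _ r])
  show ?thesis
  proof
    assume L: ?L
    then show "x = ?R"
      using R * by (intro strategy_profiles_eqI[of x I A ?R]) (auto simp: O_equilibrium_def)
  next
    assume eq: "x = ?R"
    \<comment> \<open>Membership must come first: the identification of reference payoffs with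
      deviation payoffs in \<open>*\<close> is available only for strategy profiles.\<close>
    then have x: "x \<in> strategy_profiles I A" using R by simp
    moreover have "x $ b = exp (n * deviation_payoff I A u i b x) /
                    (\<Sum>c\<in>A i. exp (n * deviation_payoff I A u i c x))"
      if "i \<in> I" "b \<in> A i" for i b
      using *[OF x that] eq by simp
    ultimately show ?L by (simp add: O_equilibrium_def)
  qed
qed


section \<open>The global chart\<close>

lemma Ck_on_own_action_game:
  assumes "open S" "\<And>i b. Ck_on k (\<lambda>z. g z i b) S"
  shows "Ck_on k (\<lambda>z. own_action_game I A (g z)) S"
proof (rule Ck_on_vec[OF assms(1)])
  show "Ck_on k (\<lambda>z. own_action_game I A (g z) $ p) S" for p
    using assms
    by (cases "p \<in> action_profiles I A \<times> I") (auto simp: own_action_game_def intro: Ck_on_const)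
qed

lemma Ck_on_vec_nth:
  "open S \<Longrightarrow> Ck_on k f S \<Longrightarrow> Ck_on k (\<lambda>z. (f z :: real ^ 'n) $ i) S"
  by (rule Ck_on_bounded_linear_compose[OF bounded_linear_vec_nth])

text \<open>The entries are polynomials in the coordinates of \<open>u\<close> and
  \<open>x\<close>.\<close>

lemma Ck_on_deviation_game:
  assumes S: "open S" and u: "Ck_on k u S" and x: "Ck_on k x S"
  shows "Ck_on k (\<lambda>z. deviation_game I A r (u z) (x z)) S"
proof -
  have "Ck_on k (\<lambda>z. residual_game I A r (u z)) S"
    unfolding residual_game_def reference_payoff_def
    by (intro Ck_on_diff Ck_on_own_action_game Ck_on_vec_nth S u)
  moreover have "Ck_on k (\<lambda>z. deviation A (x z) i b $ c) S" for i b c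
    unfolding deviation_def using Ck_on_vec_nth[OF S x] Ck_on_const[OF S]
    by (cases "c \<in> A i") auto
  then have "Ck_on k (\<lambda>z. deviation A (x z) i b) S" for i b
    by (rule Ck_on_vec[OF S])
  ultimately show ?thesis
    unfolding deviation_game_def expected_payoff_def
    by (intro Ck_on_own_action_game Ck_on_sum Ck_on_mult Ck_on_prod Ck_on_vec_nth S)
qed

lemma Ck_on_logit_response:
  assumes form: "strategic_game_form I A" and S: "open S"
    and g: "\<And>i b. Ck_on k (\<lambda>z. g z i b) S"
  shows "Ck_on k (\<lambda>z. logit_response n I A (g z)) S"
proof (rule Ck_on_vec[OF S])
  fix c
  have e: "Ck_on k (\<lambda>z. exp (n * g z i b)) S" for i b
    by (intro Ck_on_exp Ck_on_mult Ck_on_const g S)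
  \<comment> \<open>Action sets are nonempty, so the denominator is a nonempty sum of positive
    exponentials and never vanishes on the ambient space.\<close>
  have nz: "(\<Sum>b\<in>A i. exp (n * g z i b)) \<noteq> 0" if "i \<in> I" for i z
    using form that
    by (intro less_imp_neq[THEN not_sym] sum_pos) (auto simp: strategic_game_form_def)
  have "Ck_on k (\<lambda>z. exp (n * g z i c) * inverse (\<Sum>b\<in>A i. exp (n * g z i b))) S" if "i \<in> I" for i
    using nz[OF that] by (intro Ck_on_mult Ck_on_inverse Ck_on_sum e S) auto
  then have "Ck_on k (\<lambda>z. if c \<in> A i then exp (n * g z i c) / (\<Sum>b\<in>A i. exp (n * g z i b)) else 0) S"
    if "i \<in> I" for i
    using that Ck_on_const[OF S] by (cases "c \<in> A i") (auto simp: divide_inverse)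
  then show "Ck_on k (\<lambda>z. logit_response n I A (g z) $ c) S"
    unfolding logit_response_def by (simp add: Ck_on_sum[OF S])
qed

section \<open>The chart and its inverse\<close>

definition equilibrium_chart where
  "equilibrium_chart n I A r = (\<lambda>(u, x). let w = u + deviation_game I A r u x in
     (w, x - logit_response n I A (reference_payoff r w)))"

text \<open>First \<open>x\<close> is recovered from \<open>w\<close> and \<open>y\<close>. Then the
  correction is subtracted, computed from \<open>w\<close> instead of \<open>u\<close>: the two
  differ by an own-action game and so have the same deviation game.\<close>

definition equilibrium_chart_inverse where
  "equilibrium_chart_inverse n I A r = (\<lambda>(w, y).
     let x = y + logit_response n I A (reference_payoff r w) in (w - deviation_game I A r w x, x))"

lemma smooth_on_equilibrium_chart:
  assumes "strategic_game_form I A"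
  shows "smooth_on (equilibrium_chart n I A r) UNIV"
  unfolding smooth_on_def equilibrium_chart_def case_prod_unfold Let_def reference_payoff_def
  by (intro allI Ck_on_Pair Ck_on_add Ck_on_diff Ck_on_deviation_game Ck_on_logit_response[OF assms]
      Ck_on_vec_nth open_UNIV Ck_on_bounded_linear[OF bounded_linear_fst]
      Ck_on_bounded_linear[OF bounded_linear_snd])

lemma smooth_on_equilibrium_chart_inverse:
  assumes "strategic_game_form I A"
  shows "smooth_on (equilibrium_chart_inverse n I A r) UNIV"
  unfolding smooth_on_def equilibrium_chart_inverse_def case_prod_unfold Let_def reference_payoff_def
  by (intro allI Ck_on_Pair Ck_on_add Ck_on_diff Ck_on_deviation_game Ck_on_logit_response[OF assms]
      Ck_on_vec_nth open_UNIV Ck_on_bounded_linear[OF bounded_linear_fst]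
      Ck_on_bounded_linear[OF bounded_linear_snd])

lemma deviation_game_add_deviation_game:
  assumes "r \<in> action_profiles I A"
  shows "deviation_game I A r (u + deviation_game I A r v y) x = deviation_game I A r u x"
  using deviation_game_add_own_action_game[OF assms] by (simp add: deviation_game_def[of I A r v y])

lemma deviation_game_diff_deviation_game:
  assumes "r \<in> action_profiles I A"
  shows "deviation_game I A r (u - deviation_game I A r v y) x = deviation_game I A r u x"
  using deviation_game_add_deviation_game[OF assms, of "u - deviation_game I A r v y" v y x] by simp

lemma diffeomorphism_equilibrium_chart:
  assumes form: "strategic_game_form I A" and r: "r \<in> action_profiles I A"
  shows "diffeomorphism_between UNIV UNIV (equilibrium_chart n I A r) (equilibrium_chart_inverse n I A r)"
proof -
  \<comment> \<open>Continuity is the case \<open>k = 0\<close> of smoothness.\<close>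
  have "continuous_on UNIV (equilibrium_chart n I A r)"
    "continuous_on UNIV (equilibrium_chart_inverse n I A r)"
    using smooth_on_equilibrium_chart[OF form] smooth_on_equilibrium_chart_inverse[OF form]
    unfolding smooth_on_def by (metis Ck_on.simps(1))+
  moreover have "equilibrium_chart_inverse n I A r (equilibrium_chart n I A r z) = z" for z
    by (simp add: equilibrium_chart_def equilibrium_chart_inverse_def case_prod_unfold Let_def
        deviation_game_add_deviation_game[OF r])
  moreover have "equilibrium_chart n I A r (equilibrium_chart_inverse n I A r z) = z" for z
    by (simp add: equilibrium_chart_def equilibrium_chart_inverse_def case_prod_unfold Let_def
        deviation_game_diff_deviation_game[OF r])
  ultimately have "homeomorphism UNIV UNIV (equilibrium_chart n I A r) (equilibrium_chart_inverse n I A r)"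
    by (intro homeomorphismI) auto
  then show ?thesis
    by (simp add: diffeomorphism_between_def smooth_on_equilibrium_chart[OF form]
        smooth_on_equilibrium_chart_inverse[OF form])
qed

text \<open>A zero second component is the logit equation. The deviation game lies in the subspace
  \<open>payoff_functions I A\<close>, so adding it does not affect membership of
  \<open>u\<close>.\<close>

lemma equilibrium_chart_mem_iff:
  assumes form: "strategic_game_form I A" and r: "r \<in> action_profiles I A"
  shows "equilibrium_chart n I A r (u, x) \<in> payoff_functions I A \<times> {0} \<longleftrightarrow>
         u \<in> payoff_functions I A \<and> x \<in> strategy_profiles I A \<and> O_equilibrium n I A u x"
  by (simp add: equilibrium_chart_def Let_def O_equilibrium_iff_logit_response[OF form r]
      deviation_game_def payoff_functions_add_iff[OF own_action_game_in_payoff_functions])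

section \<open>Dimension of the model subspace\<close>

lemma payoff_functions_times_zero_eq:
  "(payoff_functions I A \<times> {0} :: ((real ^ (('i::finite \<Rightarrow> 'a::finite) \<times> 'i)) \<times> (real ^ 'a)) set) =
   {z. \<forall>b\<in>Basis. b \<notin> (\<lambda>p. (axis p 1, 0)) ` (action_profiles I A \<times> I) \<longrightarrow> z \<bullet> b = 0}"
proof -
  let ?e = "\<lambda>p. (axis p 1, 0) :: (real ^ (('i \<Rightarrow> 'a) \<times> 'i)) \<times> (real ^ 'a)"
  let ?f = "\<lambda>c. (0, axis c 1) :: (real ^ (('i \<Rightarrow> 'a) \<times> 'i)) \<times> (real ^ 'a)"
  have Basis: "Basis = range ?e \<union> range ?f"
    by (auto simp: Basis_prod_def Basis_vec_def)
  \<comment> \<open>No strategy direction \<open>?f c\<close> is among the free basis vectors, which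
    forces the whole second component to vanish.\<close>
  have notin: "?e p \<in> ?e ` P \<longleftrightarrow> p \<in> P" "?f c \<notin> ?e ` P" for p c P
    by (auto simp: axis_eq_axis)
  have "(\<forall>b\<in>Basis. b \<notin> ?e ` P \<longrightarrow> z \<bullet> b = 0) \<longleftrightarrow>
      (\<forall>p. p \<notin> P \<longrightarrow> fst z $ p = 0) \<and> snd z = 0" for z P
    unfolding Basis ball_Un ball_simps notin(1)
    by (simp add: notin(2) inner_prod_def inner_axis vec_eq_iff[of _ "0 :: real ^ 'a"])
  then show ?thesis unfolding payoff_functions_def by (intro set_eqI) (simp add: mem_Times_iff)
qed

text \<open>In the form just derived, the space is cut out by vanishing basis coordinates, so its
  dimension counts the remaining basis vectors, one for each pair of an action profile and a
  player.\<close>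

lemma dim_payoff_functions_times_zero:
  "dim (payoff_functions I A \<times> {0} :: ((real ^ (('i::finite \<Rightarrow> 'a::finite) \<times> 'i)) \<times> (real ^ 'a)) set) =
   card (action_profiles I A) * card I"
proof -
  let ?e = "\<lambda>p. (axis p 1, 0) :: (real ^ (('i \<Rightarrow> 'a) \<times> 'i)) \<times> (real ^ 'a)"
  have "inj_on ?e (action_profiles I A \<times> I)" by (auto simp: inj_on_def axis_eq_axis)
  moreover have "?e ` (action_profiles I A \<times> I) \<subseteq> Basis"
    by (auto simp: Basis_prod_def Basis_vec_def)
  ultimately show ?thesis
    unfolding payoff_functions_times_zero_eq
    by (subst dim_substandard) (auto simp: card_image card_cartesian_product)
qed

lemma subspace_payoff_functions: "subspace (payoff_functions I A)"
  by (auto simp: subspace_def payoff_functions_def)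

theorem theorem5p5:
  fixes I :: "'i::finite set" and A :: "'i \<Rightarrow> 'a::finite set" and n :: real
  assumes "strategic_game_form I A" and "n > 0"
  shows "smooth_submanifold (card (action_profiles I A) * card I)
           {(u, x). u \<in> payoff_functions I A \<and> x \<in> strategy_profiles I A \<and>
                    O_equilibrium n I A u x}"
    (is "smooth_submanifold _ ?M")
proof -
  \<comment> \<open>A reference profile exists because every player in \<open>I\<close> has an
    action.\<close>
  obtain r where r: "r \<in> action_profiles I A"
    using assms(1) by (metis PiE_eq_empty_iff all_not_in_conv strategic_game_form_def)
  let ?\<phi> = "equilibrium_chart n I A r" and ?\<psi> = "equilibrium_chart_inverse n I A r"
  let ?L = "payoff_functions I A \<times> {0}"
  have diffeo: "diffeomorphism_between UNIV UNIV ?\<phi> ?\<psi>"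
    by (rule diffeomorphism_equilibrium_chart[OF assms(1) r])
  then have "?\<phi> (?\<psi> z) = z" for z
    unfolding diffeomorphism_between_def homeomorphism_def by blast
  \<comment> \<open>Surjectivity turns the preimage description of \<open>?M\<close> into the image
    equality that a slice chart requires; this one chart serves every point of
    \<open>?M\<close>.\<close>
  then have "surj ?\<phi>" by (rule surjI)
  moreover have "?M = ?\<phi> -` ?L"
    by (simp add: vimage_def case_prod_unfold flip: equilibrium_chart_mem_iff[OF assms(1) r])
  ultimately have "?\<phi> ` (UNIV \<inter> ?M) = UNIV \<inter> ?L" by (simp add: surj_image_vimage_eq)
  moreover have "subspace ?L"
    by (intro subspace_Times subspace_payoff_functions subspace_single_0)
  ultimately show ?thesis
    unfolding smooth_submanifold_def
    using diffeo dim_payoff_functions_times_zero by blast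
qed

end
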